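(* Let $A=V_{\mathbb R}/\Gamma$ be a torus with $\dim_{\mathbb R}V_{\mathbb R}=4n$, $n\ge1$, endowed with a complex structure $I\colon V_{\mathbb R}\to V_{\mathbb R}$, and let $\Omega$ be an alternating $2$-form on $V_{\mathbb R}$. If $\Omega$ represents a Kähler class in $H^{1,1}(A,\mathbb R)$, then there are no twistor lines passing through $I$ in $Compl_\Omega$.
   Context: $Compl=\{L\in End(V_{\mathbb R})\mid L^2=-1\}$, and $Compl_\Omega=\{L\in Compl\mid\Omega(L\cdot,L\cdot)=\Omega(\cdot,\cdot)\}$. If $L,J\in Compl$ anticommute and $K=LJ$, the twistor line (twistor sphere) they determine is $S(L,J)=\{aL+bJ+cK\mid a^2+b^2+c^2=1\}\subset Compl$. Here "a twistor line in $Compl_\Omega$" means a twistor line contained in $Compl_\Omega$. $\Gamma\subset V_{\mathbb R}$ is a lattice, and alternating forms on $V_{\mathbb R}$ are identified with classes in $H^2(A,\mathbb R)$. *)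

theory Defs
  imports "HOL-Analysis.Analysis"
begin

text \<open>
  The finite-dimensional real vector space \<open>V\<^sub>\<real>\<close> is a type of class \<open>euclidean_space\<close>; its inner
  product serves only to provide the standard topology and is never mentioned below.
\<close>

section \<open>Complex structures and twistor lines\<close>

definition Compl :: "('v::real_vector \<Rightarrow> 'v) set" where
  "Compl = {L. linear L \<and> (\<forall>x. L (L x) = - x)}"

definition Compl_form :: "('v::real_vector \<Rightarrow> 'v \<Rightarrow> real) \<Rightarrow> ('v \<Rightarrow> 'v) set" where
  "Compl_form \<Omega> = {L \<in> Compl. \<forall>u v. \<Omega> (L u) (L v) = \<Omega> u v}"

definition anticommute :: "('v::real_vector \<Rightarrow> 'v) \<Rightarrow> ('v \<Rightarrow> 'v) \<Rightarrow> bool" where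
  "anticommute L J \<longleftrightarrow> (\<forall>x. L (J x) = - J (L x))"

definition twistor_sphere :: "('v::real_vector \<Rightarrow> 'v) \<Rightarrow> ('v \<Rightarrow> 'v) \<Rightarrow> ('v \<Rightarrow> 'v) set" where
  "twistor_sphere L J =
     {(\<lambda>x. a *\<^sub>R L x + b *\<^sub>R J x + c *\<^sub>R (L \<circ> J) x) | a b c::real. a\<^sup>2 + b\<^sup>2 + c\<^sup>2 = 1}"

definition twistor_line :: "('v::real_vector \<Rightarrow> 'v) set \<Rightarrow> bool" where
  "twistor_line S \<longleftrightarrow>
     (\<exists>L\<in>Compl. \<exists>J\<in>Compl. anticommute L J \<and> S = twistor_sphere L J)"

section \<open>Lattices, and differential forms on the torus\<close>

definition lattice_in :: "'v::euclidean_space set \<Rightarrow> bool" where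
  "lattice_in \<Gamma> \<longleftrightarrow>
     (\<exists>B. independent B \<and> span B = UNIV \<and>
          \<Gamma> = {(\<Sum>b\<in>B. of_int (k b) *\<^sub>R b) | k :: 'v \<Rightarrow> int. True})"

definition alternating_form :: "('v::real_vector \<Rightarrow> 'v \<Rightarrow> real) \<Rightarrow> bool" where
  "alternating_form \<beta> \<longleftrightarrow> bilinear \<beta> \<and> (\<forall>v. \<beta> v v = 0)"

fun Ck_fun :: "nat \<Rightarrow> ('v::euclidean_space \<Rightarrow> real) \<Rightarrow> bool" where
  "Ck_fun 0 f \<longleftrightarrow> continuous_on UNIV f"
| "Ck_fun (Suc k) f \<longleftrightarrow>
     (\<forall>x. f differentiable (at x)) \<and> (\<forall>v. Ck_fun k (\<lambda>x. frechet_derivative f (at x) v))"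

definition smooth_fun :: "('v::euclidean_space \<Rightarrow> real) \<Rightarrow> bool" where
  "smooth_fun f \<longleftrightarrow> (\<forall>k. Ck_fun k f)"

text \<open>
  Smooth forms on the torus \<open>A = V\<^sub>\<real> / \<Gamma>\<close> are given by their pullbacks to \<open>V\<^sub>\<real>\<close>, that is, as smooth
  \<open>\<Gamma>\<close>-periodic forms on \<open>V\<^sub>\<real>\<close>. A form takes the base point as its first argument.
\<close>

definition torus_forms1 :: "'v::euclidean_space set \<Rightarrow> ('v \<Rightarrow> 'v \<Rightarrow> real) set" where
  "torus_forms1 \<Gamma> = {\<eta>.
     (\<forall>x. linear (\<eta> x)) \<and> (\<forall>v. smooth_fun (\<lambda>x. \<eta> x v)) \<and>
     (\<forall>x. \<forall>\<gamma>\<in>\<Gamma>. \<eta> (x + \<gamma>) = \<eta> x)}"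

definition torus_forms2 :: "'v::euclidean_space set \<Rightarrow> ('v \<Rightarrow> 'v \<Rightarrow> 'v \<Rightarrow> real) set" where
  "torus_forms2 \<Gamma> = {\<omega>.
     (\<forall>x. alternating_form (\<omega> x)) \<and> (\<forall>u v. smooth_fun (\<lambda>x. \<omega> x u v)) \<and>
     (\<forall>x. \<forall>\<gamma>\<in>\<Gamma>. \<omega> (x + \<gamma>) = \<omega> x)}"

text \<open>Exterior derivatives, evaluated on constant vector fields (whose brackets vanish).\<close>

definition ext_deriv1 :: "('v::euclidean_space \<Rightarrow> 'v \<Rightarrow> real) \<Rightarrow> 'v \<Rightarrow> 'v \<Rightarrow> 'v \<Rightarrow> real" where
  "ext_deriv1 \<eta> x u v =
     frechet_derivative (\<lambda>y. \<eta> y v) (at x) u - frechet_derivative (\<lambda>y. \<eta> y u) (at x) v"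

definition ext_deriv2 ::
  "('v::euclidean_space \<Rightarrow> 'v \<Rightarrow> 'v \<Rightarrow> real) \<Rightarrow> 'v \<Rightarrow> 'v \<Rightarrow> 'v \<Rightarrow> 'v \<Rightarrow> real" where
  "ext_deriv2 \<omega> x u v w =
     frechet_derivative (\<lambda>y. \<omega> y v w) (at x) u
   - frechet_derivative (\<lambda>y. \<omega> y u w) (at x) v
   + frechet_derivative (\<lambda>y. \<omega> y u v) (at x) w"

section \<open>De Rham cohomology in degree two and Kaehler classes\<close>

definition closed_forms2 :: "'v::euclidean_space set \<Rightarrow> ('v \<Rightarrow> 'v \<Rightarrow> 'v \<Rightarrow> real) set" where
  "closed_forms2 \<Gamma> = {\<omega> \<in> torus_forms2 \<Gamma>. \<forall>x u v w. ext_deriv2 \<omega> x u v w = 0}"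

definition cohomologous ::
  "'v::euclidean_space set \<Rightarrow> (('v \<Rightarrow> 'v \<Rightarrow> 'v \<Rightarrow> real) \<times> ('v \<Rightarrow> 'v \<Rightarrow> 'v \<Rightarrow> real)) set" where
  "cohomologous \<Gamma> = {(\<omega>, \<omega>'). \<omega> \<in> closed_forms2 \<Gamma> \<and> \<omega>' \<in> closed_forms2 \<Gamma> \<and>
     (\<exists>\<eta>\<in>torus_forms1 \<Gamma>. \<forall>x u v. \<omega>' x u v - \<omega> x u v = ext_deriv1 \<eta> x u v)}"

definition H2 :: "'v::euclidean_space set \<Rightarrow> ('v \<Rightarrow> 'v \<Rightarrow> 'v \<Rightarrow> real) set set" where
  "H2 \<Gamma> = closed_forms2 \<Gamma> // cohomologous \<Gamma>"

text \<open>
  The identification of alternating forms on \<open>V\<^sub>\<real>\<close> with classes in \<open>H\<^sup>2(A, \<real>)\<close>: a form is sent to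
  the class of the translation-invariant form it defines on \<open>A\<close>.
\<close>

definition form_class ::
  "'v::euclidean_space set \<Rightarrow> ('v \<Rightarrow> 'v \<Rightarrow> real) \<Rightarrow> ('v \<Rightarrow> 'v \<Rightarrow> 'v \<Rightarrow> real) set" where
  "form_class \<Gamma> \<Omega> = cohomologous \<Gamma> `` {\<lambda>x. \<Omega>}"

text \<open>
  An element \<open>a + \<i> b\<close> of \<open>V\<^sub>\<real> \<otimes> \<complex>\<close> is written as the pair \<open>(a, b)\<close>, and \<open>complexify \<beta>\<close> is the
  \<open>\<complex>\<close>-bilinear extension of \<open>\<beta>\<close>. The vectors of type (1,0) are the \<open>u - \<i> I u\<close>, those of
  type (0,1) the \<open>u + \<i> I u\<close>.
\<close>

definition complexify ::
  "('v::real_vector \<Rightarrow> 'v \<Rightarrow> real) \<Rightarrow> 'v \<times> 'v \<Rightarrow> 'v \<times> 'v \<Rightarrow> complex" where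
  "complexify \<beta> p q =
     Complex (\<beta> (fst p) (fst q) - \<beta> (snd p) (snd q)) (\<beta> (fst p) (snd q) + \<beta> (snd p) (fst q))"

definition type_1_1 :: "('v::real_vector \<Rightarrow> 'v) \<Rightarrow> ('v \<Rightarrow> 'v \<Rightarrow> real) \<Rightarrow> bool" where
  "type_1_1 I \<beta> \<longleftrightarrow>
     (\<forall>u v. complexify \<beta> (u, - I u) (v, - I v) = 0 \<and> complexify \<beta> (u, I u) (v, I v) = 0)"

lemma type_1_1_iff_invariant:
  assumes "I \<in> Compl" "alternating_form \<beta>"
  shows "type_1_1 I \<beta> \<longleftrightarrow> (\<forall>u v. \<beta> (I u) (I v) = \<beta> u v)"
proof -
  have bil: "bilinear \<beta>" using assms(2) by (simp add: alternating_form_def)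
  have I2: "I (I x) = - x" for x using assms(1) by (simp add: Compl_def)
  have sum: "\<beta> u (I v) + \<beta> (I u) v = 0" if "\<forall>u v. \<beta> (I u) (I v) = \<beta> u v" for u v
    using that[rule_format, of "I u" v] by (simp add: I2 bilinear_lneg[OF bil])
  have neg: "\<beta> u (I v) = - \<beta> (I u) v" if "\<forall>u v. \<beta> (I u) (I v) = \<beta> u v" for u v
    using sum[OF that, of u v] by simp
  show ?thesis
  proof
    assume t: "type_1_1 I \<beta>"
    show "\<forall>u v. \<beta> (I u) (I v) = \<beta> u v"
    proof (intro allI)
      fix u v
      have "complexify \<beta> (u, I u) (v, I v) = 0" using t by (simp add: type_1_1_def)
      thus "\<beta> (I u) (I v) = \<beta> u v" by (simp add: complexify_def complex_eq_iff)
    qed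
  next
    assume inv: "\<forall>u v. \<beta> (I u) (I v) = \<beta> u v"
    have "\<beta> u (I v) = - \<beta> (I u) v" "\<beta> (I u) (I v) = \<beta> u v" for u v
      using neg[OF inv] inv by blast+
    thus "type_1_1 I \<beta>"
      unfolding type_1_1_def complexify_def complex_eq_iff fst_conv snd_conv
        bilinear_lneg[OF bil] bilinear_rneg[OF bil] by simp
  qed
qed

definition H11 :: "'v::euclidean_space set \<Rightarrow> ('v \<Rightarrow> 'v) \<Rightarrow> ('v \<Rightarrow> 'v \<Rightarrow> 'v \<Rightarrow> real) set set" where
  "H11 \<Gamma> I = {c \<in> H2 \<Gamma>. \<exists>\<omega>\<in>c. \<forall>x. type_1_1 I (\<omega> x)}"

text \<open>Sign convention: the metric of a Kaehler form \<open>\<omega>\<close> is \<open>g(u, v) = \<omega>(u, I v)\<close>.\<close>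

definition kaehler_form ::
  "'v::euclidean_space set \<Rightarrow> ('v \<Rightarrow> 'v) \<Rightarrow> ('v \<Rightarrow> 'v \<Rightarrow> 'v \<Rightarrow> real) \<Rightarrow> bool" where
  "kaehler_form \<Gamma> I \<omega> \<longleftrightarrow>
     \<omega> \<in> closed_forms2 \<Gamma> \<and> (\<forall>x. type_1_1 I (\<omega> x)) \<and> (\<forall>x v. v \<noteq> 0 \<longrightarrow> \<omega> x v (I v) > 0)"

definition kaehler_classes ::
  "'v::euclidean_space set \<Rightarrow> ('v \<Rightarrow> 'v) \<Rightarrow> ('v \<Rightarrow> 'v \<Rightarrow> 'v \<Rightarrow> real) set set" where
  "kaehler_classes \<Gamma> I = {c \<in> H11 \<Gamma> I. \<exists>\<omega>\<in>c. kaehler_form \<Gamma> I \<omega>}"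

end

theory Submission
  imports Defs
begin

text \<open>
  If \<open>\<Omega>\<close> represents a Kaehler class, then the constant form \<open>\<Omega>\<close> is itself positive:
  \<open>\<Omega>(v, I v) > 0\<close> for all \<open>v \<noteq> 0\<close> (\<open>kaehler_class_positive\<close>). On the other hand, a twistor line through
  \<open>I\<close> contains some \<open>M\<close> that anticommutes with \<open>I\<close> (\<open>twistor_sphere_orthogonal\<close>), and if \<open>M\<close>
  preserves \<open>\<Omega>\<close>, then \<open>\<Omega>(M v, I M v) = - \<Omega>(M v, M I v) = - \<Omega>(v, I v)\<close>. So the form
  \<open>v \<mapsto> \<Omega>(v, I v)\<close> takes both signs, which contradicts positivity.

  Positivity is usually obtained by averaging a Kaehler form \<open>\<omega>\<close> in the class over the torus, which
  kills the exact part \<open>d\<eta> = \<omega> - \<Omega>\<close>. Here it suffices to average over large squares in the plane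
  spanned by \<open>v\<close> and \<open>I v\<close>. If \<open>\<Omega>(v, I v) \<le> 0\<close>, then \<open>d\<eta>(v, I v)\<close> is at
  least \<open>\<omega>(v, I v)\<close>, hence bounded below by a constant \<open>c > 0\<close> by periodicity and
  compactness. The integral of \<open>d\<eta>\<close> over a square of side \<open>T\<close> is then at least \<open>c T\<^sup>2\<close>, while by
  Green's theorem it is a boundary integral, of size \<open>O(T)\<close> because \<open>\<eta>\<close> is bounded
  (\<open>bounded_plane_curl_not_pos\<close>).
\<close>

section \<open>Periodic continuous functions\<close>

text \<open>
  Subtracting the integer parts of the coordinates moves any point into the fundamental
  parallelepiped, which is bounded. This is compactness of the torus in the form in which periodic
  functions use it.
\<close>

lemma lattice_in_translate_cball:
  fixes \<Gamma> :: "'v::euclidean_space set"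
  assumes "lattice_in \<Gamma>"
  obtains R where "R \<ge> 0" "\<And>x. \<exists>\<gamma>\<in>\<Gamma>. x + \<gamma> \<in> cball 0 R"
proof -
  obtain B where B: "independent B" "span B = UNIV"
      "\<Gamma> = {(\<Sum>b\<in>B. of_int (k b) *\<^sub>R b) | k :: 'v \<Rightarrow> int. True}"
    using assms unfolding lattice_in_def by blast
  have fin: "finite B" using B(1) by (rule independent_imp_finite)
  define R where "R = (\<Sum>b\<in>B. norm b)"
  have "\<exists>\<gamma>\<in>\<Gamma>. x + \<gamma> \<in> cball 0 R" for x
  proof -
    have "x \<in> span B" using B(2) by simp
    then obtain t where t: "x = (\<Sum>b\<in>B. t b *\<^sub>R b)"
      unfolding span_finite[OF fin] by auto
    define \<gamma> where "\<gamma> = (\<Sum>b\<in>B. of_int (- \<lfloor>t b\<rfloor>) *\<^sub>R b)"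
    have mem: "\<gamma> \<in> \<Gamma>"
      unfolding B(3) mem_Collect_eq \<gamma>_def by (rule exI[of _ "\<lambda>b. - \<lfloor>t b\<rfloor>"]) simp
    have "x + \<gamma> = (\<Sum>b\<in>B. frac (t b) *\<^sub>R b)"
      unfolding t \<gamma>_def sum.distrib[symmetric]
      by (rule sum.cong) (auto simp: frac_def algebra_simps)
    also have "norm \<dots> \<le> R"
      unfolding R_def
    proof (rule sum_norm_le)
      fix b
      have "frac (t b) * norm b \<le> 1 * norm b"
        using frac_lt_1[of "t b"] by (intro mult_right_mono) auto
      thus "norm (frac (t b) *\<^sub>R b) \<le> norm b" by (simp add: frac_ge_0)
    qed
    finally show ?thesis using mem by (intro bexI[of _ \<gamma>]) auto
  qed
  moreover have "R \<ge> 0" unfolding R_def by (intro sum_nonneg) auto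
  ultimately show ?thesis using that by blast
qed

lemma periodic_continuous_attains_inf:
  fixes f :: "'v::euclidean_space \<Rightarrow> real"
  assumes "lattice_in \<Gamma>" "continuous_on UNIV f"
    and per: "\<And>x \<gamma>. \<gamma> \<in> \<Gamma> \<Longrightarrow> f (x + \<gamma>) = f x"
  obtains x0 where "\<And>x. f x0 \<le> f x"
proof -
  obtain R where R: "R \<ge> 0" "\<And>x. \<exists>\<gamma>\<in>\<Gamma>. x + \<gamma> \<in> cball 0 R"
    using lattice_in_translate_cball[OF assms(1)] by blast
  have "cball (0::'v) R \<noteq> {}" using R(1) by simp
  from continuous_attains_inf[OF compact_cball this continuous_on_subset[OF assms(2) subset_UNIV]]
  obtain x0 where x0: "\<And>y. y \<in> cball 0 R \<Longrightarrow> f x0 \<le> f y"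
    by metis
  have "f x0 \<le> f x" for x
    using R(2)[of x] x0 per by metis
  thus ?thesis using that by blast
qed

lemma periodic_continuous_bounded:
  fixes f :: "'v::euclidean_space \<Rightarrow> real"
  assumes "lattice_in \<Gamma>" "continuous_on UNIV f"
    and "\<And>x \<gamma>. \<gamma> \<in> \<Gamma> \<Longrightarrow> f (x + \<gamma>) = f x"
  obtains M where "\<And>x. \<bar>f x\<bar> \<le> M"
proof -
  have "continuous_on UNIV (\<lambda>x. - \<bar>f x\<bar>)"
    using assms(2) by (intro continuous_intros)
  then obtain x0 where "\<And>x. - \<bar>f x0\<bar> \<le> - \<bar>f x\<bar>"
    using periodic_continuous_attains_inf[OF assms(1), of "\<lambda>x. - \<bar>f x\<bar>"] assms(3) by auto
  thus ?thesis using that[of "\<bar>f x0\<bar>"] by simp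
qed

section \<open>Bounded functions on the plane\<close>

text \<open>
  Green's theorem on the rectangle \<open>[0, s] \<times> [0, T]\<close> compares area with perimeter. The function
  \<open>\<phi>\<close> below is the integral of \<open>f\<close> over the side with abscissa \<open>s\<close>: it is bounded in \<open>s\<close>,
  yet it grows at least linearly once \<open>T\<close> is so large that \<open>c T\<close> exceeds the variation of \<open>g\<close>.
\<close>

lemma bounded_plane_curl_not_pos:
  fixes f g fs gt :: "real \<Rightarrow> real \<Rightarrow> real"
  assumes df: "\<And>s t. ((\<lambda>s. f s t) has_real_derivative fs s t) (at s)"
    and dg: "\<And>s t. (g s has_real_derivative gt s t) (at t)"
    and cf: "\<And>s. continuous_on UNIV (f s)"
    and cfs: "continuous_on UNIV (\<lambda>(s, t). fs s t)"
    and bf: "\<And>s t. \<bar>f s t\<bar> \<le> M"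
    and bg: "\<And>s t. \<bar>g s t\<bar> \<le> M"
    and "c > 0"
  shows "\<exists>s t. fs s t - gt s t < c"
proof (rule ccontr)
  assume "\<not> ?thesis"
  hence lower: "c + gt s t \<le> fs s t" for s t
    by (metis add.commute le_diff_eq not_less)
  have M: "M \<ge> 0" using bf[of 0 0] by linarith
  define T where "T = (2 * M + 1) / c"
  have T: "T > 0" "c * T = 2 * M + 1" using \<open>c > 0\<close> M by (auto simp: T_def)
  define \<phi> where "\<phi> s = integral {0..T} (f s)" for s
  define \<phi>' where "\<phi>' s = integral {0..T} (fs s)" for s
  have intf: "f s integrable_on {0..T}" for s
    using continuous_on_subset[OF cf] by (intro integrable_continuous_interval) auto
  have cfs1: "continuous_on {0..T} (fs s)" for s
    using continuous_on_compose2[OF cfs, of "{0..T}" "\<lambda>t. (s, t)"]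
    by (simp add: continuous_on_Pair continuous_on_const continuous_on_id)
  have d\<phi>: "(\<phi> has_real_derivative \<phi>' s) (at s)" for s
    unfolding \<phi>_def \<phi>'_def
    using leibniz_rule_field_derivative[of UNIV 0 T f fs s] df intf
      continuous_on_subset[OF cfs, of "UNIV \<times> {0..T}"]
    by simp
  have growth: "\<phi>' s \<ge> 1" for s
  proof -
    have ftc: "(gt s has_integral (g s T - g s 0)) {0..T}"
      using T(1) dg
      by (intro fundamental_theorem_of_calculus)
        (auto simp: has_real_derivative_iff_has_vector_derivative[symmetric]
          intro: has_field_derivative_at_within)
    have "((\<lambda>t. c + gt s t) has_integral (c * T + (g s T - g s 0))) {0..T}"
      using has_integral_add[OF has_integral_const_real[of c 0 T] ftc] T(1)
      by (simp add: mult.commute)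
    hence "c * T + (g s T - g s 0) \<le> \<phi>' s"
      unfolding \<phi>'_def
      by (rule has_integral_le[OF _ integrable_integral[OF integrable_continuous_interval[OF cfs1]]])
        (rule lower)
    moreover have "g s T - g s 0 \<ge> - (2 * M)" using bg[of s T] bg[of s 0] by linarith
    ultimately show ?thesis using T(2) by linarith
  qed
  have bound: "\<bar>\<phi> s\<bar> \<le> M * T" for s
    using has_integral_bound_real[OF M finite.emptyI integrable_integral[OF intf[of s]]] bf T(1)
    by (simp add: \<phi>_def)
  define s where "s = 2 * (M * T) + 1"
  have s: "s > 0" using M T(1) by (simp add: s_def add_nonneg_pos)
  obtain z where "\<phi> s - \<phi> 0 = (s - 0) * \<phi>' z"
    using MVT2[OF s, of \<phi> \<phi>'] d\<phi> by blast
  moreover have "s * 1 \<le> s * \<phi>' z" using growth s by (intro mult_left_mono) auto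
  ultimately have "\<phi> s - \<phi> 0 \<ge> s" by simp
  thus False using bound[of s] bound[of 0] by (simp add: s_def)
qed

section \<open>Positivity of constant forms in a Kaehler class\<close>

lemma smooth_fun_C1:
  assumes "smooth_fun f"
  shows "continuous_on UNIV f" "(f has_derivative frechet_derivative f (at x)) (at x)"
    "continuous_on UNIV (\<lambda>x. frechet_derivative f (at x) v)"
proof -
  have "Ck_fun 0 f" "Ck_fun (Suc 0) f" using assms unfolding smooth_fun_def by blast+
  thus "continuous_on UNIV f" "(f has_derivative frechet_derivative f (at x)) (at x)"
    "continuous_on UNIV (\<lambda>x. frechet_derivative f (at x) v)"
    by (auto simp: frechet_derivative_works)
qed

lemma smooth_fun_directional_derivative:
  assumes "smooth_fun f"
  shows "((\<lambda>s. f (p + s *\<^sub>R u)) has_real_derivative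
            frechet_derivative f (at (p + s *\<^sub>R u)) u) (at s)"
proof -
  let ?D = "frechet_derivative f (at (p + s *\<^sub>R u))"
  have D: "(f has_derivative ?D) (at (p + s *\<^sub>R u))" by (rule smooth_fun_C1(2)[OF assms])
  have "((\<lambda>s. p + s *\<^sub>R u) has_derivative (\<lambda>h. h *\<^sub>R u)) (at s)"
    by (auto intro!: derivative_eq_intros)
  from has_derivative_compose[OF this D]
  have "((\<lambda>s. f (p + s *\<^sub>R u)) has_derivative (\<lambda>h. ?D (h *\<^sub>R u))) (at s)" .
  moreover have "?D (h *\<^sub>R u) = ?D u * h" for h
    using linear_cmul[OF has_derivative_linear[OF D]] by (simp add: mult.commute)
  ultimately show ?thesis by (simp add: has_field_derivative_def)
qed

text \<open>
  The mean of \<open>d\<eta>(u, w)\<close> over large squares with sides in the directions \<open>u\<close> and \<open>w\<close> tends to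
  zero, because \<open>\<eta>\<close> is bounded by periodicity. This replaces Stokes' theorem on the torus, whose
  lattice need not meet the plane of \<open>u\<close> and \<open>w\<close> outside the origin.
\<close>

lemma ext_deriv1_not_bounded_below:
  fixes \<Gamma> :: "'v::euclidean_space set"
  assumes \<Gamma>: "lattice_in \<Gamma>" and \<eta>: "\<eta> \<in> torus_forms1 \<Gamma>" and "c > 0"
  shows "\<exists>x. ext_deriv1 \<eta> x u w < c"
proof -
  have sm: "smooth_fun (\<lambda>x. \<eta> x v)" for v using \<eta> by (simp add: torus_forms1_def)
  have bd: "\<exists>M. \<forall>x. \<bar>\<eta> x v\<bar> \<le> M" for v
  proof -
    have "\<eta> (x + \<gamma>) v = \<eta> x v" if "\<gamma> \<in> \<Gamma>" for x \<gamma>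
      using \<eta> that by (simp add: torus_forms1_def)
    thus ?thesis
      by (rule periodic_continuous_bounded[OF \<Gamma> smooth_fun_C1(1)[OF sm[of v]]]) blast+
  qed
  obtain M1 M2 where M: "\<And>x. \<bar>\<eta> x w\<bar> \<le> M1" "\<And>x. \<bar>\<eta> x u\<bar> \<le> M2"
    using bd[of w] bd[of u] by blast
  define P where "P s t = s *\<^sub>R u + t *\<^sub>R w" for s t :: real
  have "\<exists>s t. frechet_derivative (\<lambda>y. \<eta> y w) (at (P s t)) u
      - frechet_derivative (\<lambda>y. \<eta> y u) (at (P s t)) w < c"
  proof (rule bounded_plane_curl_not_pos[where M = "max M1 M2" and
        f = "\<lambda>s t. \<eta> (P s t) w" and g = "\<lambda>s t. \<eta> (P s t) u"])
    fix s t :: real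
    show "((\<lambda>s. \<eta> (P s t) w) has_real_derivative
        frechet_derivative (\<lambda>y. \<eta> y w) (at (P s t)) u) (at s)"
      using smooth_fun_directional_derivative[OF sm[of w], of "t *\<^sub>R w" u s]
      by (simp add: P_def add.commute)
    show "((\<lambda>t. \<eta> (P s t) u) has_real_derivative
        frechet_derivative (\<lambda>y. \<eta> y u) (at (P s t)) w) (at t)"
      using smooth_fun_directional_derivative[OF sm[of u], of "s *\<^sub>R u" w t]
      by (simp add: P_def)
    show "continuous_on UNIV (\<lambda>t. \<eta> (P s t) w)"
      unfolding P_def
      by (rule continuous_on_compose2[OF smooth_fun_C1(1)[OF sm]])
        (auto intro!: continuous_intros)
    show "\<bar>\<eta> (P s t) w\<bar> \<le> max M1 M2" "\<bar>\<eta> (P s t) u\<bar> \<le> max M1 M2"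
      using M(1)[of "P s t"] M(2)[of "P s t"] by linarith+
  next
    show "continuous_on UNIV (\<lambda>(s, t). frechet_derivative (\<lambda>y. \<eta> y w) (at (P s t)) u)"
      unfolding P_def case_prod_unfold
      by (rule continuous_on_compose2[OF smooth_fun_C1(3)[OF sm]])
        (auto intro!: continuous_intros)
  qed fact
  thus ?thesis unfolding ext_deriv1_def by blast
qed

lemma kaehler_class_positive:
  fixes \<Gamma> :: "'v::euclidean_space set"
  assumes \<Gamma>: "lattice_in \<Gamma>" and cls: "form_class \<Gamma> \<Omega> \<in> kaehler_classes \<Gamma> I" and "v \<noteq> 0"
  shows "\<Omega> v (I v) > 0"
proof (rule ccontr)
  assume "\<not> ?thesis"
  hence nonpos: "\<Omega> v (I v) \<le> 0" by simp
  obtain \<omega> where "\<omega> \<in> form_class \<Gamma> \<Omega>" and K: "kaehler_form \<Gamma> I \<omega>"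
    using cls unfolding kaehler_classes_def by blast
  then obtain \<eta> where \<eta>: "\<eta> \<in> torus_forms1 \<Gamma>"
      and diff: "\<And>x u w. \<omega> x u w - \<Omega> u w = ext_deriv1 \<eta> x u w"
    unfolding form_class_def cohomologous_def by auto
  have \<omega>: "\<omega> \<in> torus_forms2 \<Gamma>" and pos: "\<And>x. \<omega> x v (I v) > 0"
    using K \<open>v \<noteq> 0\<close> unfolding kaehler_form_def closed_forms2_def by auto
  have "continuous_on UNIV (\<lambda>x. \<omega> x v (I v))"
    using \<omega> smooth_fun_C1(1) unfolding torus_forms2_def by blast
  moreover have "\<omega> (x + \<gamma>) v (I v) = \<omega> x v (I v)" if "\<gamma> \<in> \<Gamma>" for x \<gamma>
    using \<omega> that unfolding torus_forms2_def by simp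
  ultimately obtain x0 where x0: "\<And>x. \<omega> x0 v (I v) \<le> \<omega> x v (I v)"
    using periodic_continuous_attains_inf[OF \<Gamma>, of "\<lambda>x. \<omega> x v (I v)"] by blast
  obtain x where "ext_deriv1 \<eta> x v (I v) < \<omega> x0 v (I v)"
    using ext_deriv1_not_bounded_below[OF \<Gamma> \<eta> pos[of x0]] by blast
  thus False using diff[of x v "I v"] x0[of x] nonpos by linarith
qed

section \<open>Anticommuting elements of a twistor line\<close>

lemma exists_unit_orthogonal3:
  fixes a b c :: real
  obtains p q r :: real where "p\<^sup>2 + q\<^sup>2 + r\<^sup>2 = 1" "a * p + b * q + c * r = 0"
proof (cases "a = 0 \<and> b = 0")
  case True
  thus ?thesis using that[of 1 0 0] by simp
next
  case False
  define d where "d = sqrt (a\<^sup>2 + b\<^sup>2)"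
  have nz: "a\<^sup>2 + b\<^sup>2 \<noteq> 0" using False by (simp add: sum_power2_eq_zero_iff)
  have d2: "d\<^sup>2 = a\<^sup>2 + b\<^sup>2" by (simp add: d_def)
  have "(- b / d)\<^sup>2 + (a / d)\<^sup>2 + 0\<^sup>2 = (a\<^sup>2 + b\<^sup>2) / d\<^sup>2"
    by (simp add: power_divide add_divide_distrib)
  also have "\<dots> = 1" using nz d2 by simp
  finally show ?thesis using that[of "- b / d" "a / d" 0] by simp
qed

text \<open>
  Quaternion multiplication gives \<open>I M + M I = -2 \<langle>I, M\<rangle>\<close> for \<open>I\<close> and \<open>M\<close> in the sphere, with
  the inner product of the coordinate vectors with respect to \<open>L\<close>, \<open>J\<close>, \<open>L J\<close>. So orthogonal
  elements anticommute.
\<close>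

lemma twistor_sphere_orthogonal:
  assumes "L \<in> Compl" "J \<in> Compl" "anticommute L J" "I \<in> twistor_sphere L J"
  obtains M where "M \<in> twistor_sphere L J" "anticommute I M"
proof -
  obtain a b c where I: "I = (\<lambda>x. a *\<^sub>R L x + b *\<^sub>R J x + c *\<^sub>R (L \<circ> J) x)"
    using assms(4) unfolding twistor_sphere_def by blast
  obtain p q r where pqr: "p\<^sup>2 + q\<^sup>2 + r\<^sup>2 = 1" "a * p + b * q + c * r = 0"
    by (rule exists_unit_orthogonal3)
  define M where "M = (\<lambda>x. p *\<^sub>R L x + q *\<^sub>R J x + r *\<^sub>R (L \<circ> J) x)"
  have lin: "linear L" "linear J" using assms by (auto simp: Compl_def)
  have sq: "L (L x) = - x" "J (J x) = - x" for x using assms by (auto simp: Compl_def)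
  \<comment> \<open>Oriented so that rewriting moves every \<open>L\<close> to the left of every \<open>J\<close>.\<close>
  have JL: "J (L x) = - L (J x)" for x
    using assms(3) unfolding anticommute_def by simp
  note expand = linear_add[OF lin(1)] linear_add[OF lin(2)] linear_cmul[OF lin(1)]
    linear_cmul[OF lin(2)] linear_neg[OF lin(1)] linear_neg[OF lin(2)]
    linear_diff[OF lin(1)] linear_diff[OF lin(2)] sq JL
  have "I (M x) + M (I x) = - (k *\<^sub>R x + k *\<^sub>R x)"
    if "k = a * p + b * q + c * r" for x k
    unfolding I M_def that o_def expand by (simp add: algebra_simps)
  from this[of 0] have "I (M x) + M (I x) = 0" for x using pqr(2) by simp
  hence "anticommute I M" unfolding anticommute_def by (simp add: eq_neg_iff_add_eq_0)
  moreover have "M \<in> twistor_sphere L J"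
    unfolding twistor_sphere_def M_def using pqr(1) by blast
  ultimately show ?thesis using that by blast
qed

lemma anticommuting_isometry_flips_sign:
  assumes "alternating_form \<Omega>" "M \<in> Compl_form \<Omega>" "anticommute I M"
  shows "\<Omega> (M v) (I (M v)) = - \<Omega> v (I v)"
proof -
  have "\<Omega> (M v) (I (M v)) = \<Omega> (M v) (- M (I v))"
    using assms(3) by (simp add: anticommute_def)
  also have "\<dots> = - \<Omega> (M v) (M (I v))"
    using assms(1) by (simp add: alternating_form_def bilinear_rneg)
  also have "\<dots> = - \<Omega> v (I v)" using assms(2) by (simp add: Compl_form_def)
  finally show ?thesis .
qed

section \<open>Twistor lines through a Kaehler structure\<close>

theorem corollary5p5:
  fixes n :: nat
    and \<Gamma> :: "'v::euclidean_space set"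
    and I :: "'v \<Rightarrow> 'v"
    and \<Omega> :: "'v \<Rightarrow> 'v \<Rightarrow> real"
  assumes "n \<ge> 1"
    and "DIM('v) = 4 * n"
    and "lattice_in \<Gamma>"
    and "I \<in> Compl"
    and "alternating_form \<Omega>"
    and "form_class \<Gamma> \<Omega> \<in> kaehler_classes \<Gamma> I"
  shows "\<not> (\<exists>S. twistor_line S \<and> I \<in> S \<and> S \<subseteq> Compl_form \<Omega>)"
proof
  assume "\<exists>S. twistor_line S \<and> I \<in> S \<and> S \<subseteq> Compl_form \<Omega>"
  then obtain L J where LJ: "L \<in> Compl" "J \<in> Compl" "anticommute L J"
      "I \<in> twistor_sphere L J" and sub: "twistor_sphere L J \<subseteq> Compl_form \<Omega>"
    unfolding twistor_line_def by blast
  obtain M where M: "M \<in> Compl_form \<Omega>" "anticommute I M"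
    using twistor_sphere_orthogonal[OF LJ] sub by blast
  obtain v :: 'v where v: "v \<noteq> 0"
    using nonempty_Basis nonzero_Basis by blast
  have lin: "linear M" and M2: "M (M v) = - v" using M(1) by (auto simp: Compl_form_def Compl_def)
  have "M v \<noteq> 0" using M2 v linear_0[OF lin] by auto
  hence "\<Omega> (M v) (I (M v)) > 0" by (rule kaehler_class_positive[OF assms(3,6)])
  moreover have "\<Omega> v (I v) > 0" using v by (rule kaehler_class_positive[OF assms(3,6)])
  ultimately show False
    using anticommuting_isometry_flips_sign[OF assms(5) M, of v] by linarith
qed

end
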